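(* Consider an RL environment whose (discounted) cumulative reward $\sum_{t=0}^{H-1}\gamma^t r_t$ is bounded in the range $[0,b]$, $b\in\mathbb{R}^+$. Let $\mathcal{M}$ be a randomized learning algorithm mapping a training dataset to a policy, let $D$ be a training dataset, and let $\pi=\mathcal{M}(D)$ be the resulting randomized policy. (ADP) If $\mathcal{M}$ preserves an ADP $(\mathcal{K},r)$-outcomes guarantee, then for each $K\in\mathcal{K}$, with corresponding parameters $\epsilon,\delta$ (i.e. $K(x)=e^{\epsilon}x+\delta$), and for any poisoned dataset $\tilde D\in\mathcal{B}(D,r)$ with $\tilde\pi=\mathcal{M}(\tilde D)$, $$J(\tilde\pi)\;\ge\; e^{-\epsilon}\big(J(\pi)-b\delta\big).$$ (RDP) If $\mathcal{M}$ preserves an RDP $(\mathcal{K},r)$-outcomes guarantee, then for each $K\in\mathcal{K}$, with corresponding parameters $\epsilon,\alpha$ (i.e. $K(x)=(e^{\epsilon}x)^{(\alpha-1)/\alpha}$), and for any poisoned dataset $\tilde D\in\mathcal{B}(D,r)$ with $\tilde\pi=\mathcal{M}(\tilde D)$, $$J(\tilde\pi)\;\ge\; e^{-\epsilon}\big(b^{-1/\alpha}J(\pi)\big)^{\frac{\alpha}{\alpha-1}}.$$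
   Context: Environment: an episodic finite-horizon Markov decision process $(\mathcal{S},\mathcal{A},P,R,H,\gamma)$ with state space $\mathcal{S}$, action space $\mathcal{A}$, stochastic transition function $P:\mathcal{S}\times\mathcal{A}\to\Delta(\mathcal{S})$ (with $\Delta(\mathcal S)$ the set of probability measures on $\mathcal S$), bounded reward function $R:\mathcal{S}\times\mathcal{A}\to\mathbb{R}$, horizon $H$, discount factor $\gamma\in\mathbb{R}$. A policy is a map $\mathcal{S}\to\mathcal{A}$; following it from the initial state (fixed or drawn from a fixed distribution), at time $t$ the agent takes action $a_t$ given by the policy at $s_t$, receives $r_t=R(s_t,a_t)$ and moves to $s_{t+1}\sim P(s_t,a_t)$. A randomized policy $\pi=\mathcal{M}(D)$ is a policy-valued random element whose randomness (denoted $\sigma$) is that of the training algorithm. Expected cumulative reward: $J(\pi)=\mathbb{E}_{\sigma}[C(\pi)]$, where $C(\pi)=\mathbb{E}_{\xi}\big[\sum_{t=0}^{H-1}\gamma^t r_t\mid\pi\big]$, $\xi$ denoting the randomness of the environment (and $\sigma$ that of the training algorithm). All maps are assumed measurable as needed. Datasets: a dataset $D$ is a finite collection of records. The records are either transitions $(s,a,s',r)$ or trajectories (sequences of transitions over an episode). $\mathcal{B}(D,r)$ is the set of all datasets $\tilde D$ such that the minimum number of record changes (additions, deletions or alterations) needed to map $D$ to $\tilde D$ is at most $r$. This relation is symmetric: $\tilde D\in\mathcal{B}(D,r)\iff D\in\mathcal{B}(\tilde D,r)$. Outcomes guarantee: a randomized function $\mathcal{M}$ on datasets preserves a $(\mathcal{K},r)$-outcomes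 guarantee, for a family $\mathcal{K}$ of functions, if for every $K\in\mathcal{K}$, all datasets $D_1$ and $D_2\in\mathcal{B}(D_1,r)$, and all measurable $S\subseteq\mathrm{Range}(\mathcal{M})$, $\Pr[\mathcal{M}(D_1)\in S]\le K(\Pr[\mathcal{M}(D_2)\in S])$. It is an ADP outcomes guarantee if each $K\in\mathcal{K}$ has the form $K(x)=e^{\epsilon}x+\delta$ with parameters $\epsilon>0$, $\delta\in[0,1)$, and an RDP outcomes guarantee if each $K\in\mathcal{K}$ has the form $K(x)=(e^{\epsilon}x)^{(\alpha-1)/\alpha}$ with parameters $\epsilon>0$, $\alpha>1$. *)

theory Defs
  imports "HOL-Probability.Probability" "HOL-Library.Multiset"
begin

section \<open>Episodic finite-horizon Markov decision processes\<close>

record ('s, 'a) mdp =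
  states :: "'s measure"
  actions :: "'a measure"
  transition :: "'s \<times> 'a \<Rightarrow> 's measure"
  reward :: "'s \<times> 'a \<Rightarrow> real"
  horizon :: nat
  discount :: real
  initial :: "'s measure"  \<comment> \<open>a point mass if the initial state is fixed\<close>

text \<open>\<^const>\<open>prob_algebra\<close> is the measurable space of probability measures, so the transition
  function is a Markov kernel. The discount factor may be any real number.\<close>

definition valid_mdp :: "('s, 'a) mdp \<Rightarrow> bool" where
  "valid_mdp E \<longleftrightarrow>
     transition E \<in> states E \<Otimes>\<^sub>M actions E \<rightarrow>\<^sub>M prob_algebra (states E) \<and>
     reward E \<in> borel_measurable (states E \<Otimes>\<^sub>M actions E) \<and>
     (\<exists>B. \<forall>x \<in> space (states E \<Otimes>\<^sub>M actions E). \<bar>reward E x\<bar> \<le> B) \<and>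
     initial E \<in> space (prob_algebra (states E))"

definition policies :: "('s, 'a) mdp \<Rightarrow> ('s \<Rightarrow> 'a) set" where
  "policies E = states E \<rightarrow>\<^sub>M actions E"

text \<open>Law of the state at time \<open>t\<close>, given the states \<open>\<tau> 0, \<dots>, \<tau> (t - 1)\<close> visited so far under
  policy \<open>p\<close>.\<close>

fun next_state :: "('s, 'a) mdp \<Rightarrow> ('s \<Rightarrow> 'a) \<Rightarrow> nat \<Rightarrow> (nat \<Rightarrow> 's) \<Rightarrow> 's measure" where
  "next_state E p 0 \<tau> = initial E"
| "next_state E p (Suc t) \<tau> = transition E (\<tau> t, p (\<tau> t))"

text \<open>Joint law of the states \<open>s\<^sub>0, \<dots>, s\<^bsub>H-1\<^esub>\<close> of an episode, a measure on \<open>PiM {0..<H} (\<lambda>_. states E)\<close>: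
  the library's composition of \<open>H\<close> kernels, started from the unique point \<open>\<lambda>_. undefined\<close> of the
  empty product. As policies are deterministic, the states determine the actions and rewards.\<close>

definition episode :: "('s, 'a) mdp \<Rightarrow> ('s \<Rightarrow> 'a) \<Rightarrow> (nat \<Rightarrow> 's) measure" where
  "episode E p =
     Ionescu_Tulcea.C (next_state E p) (\<lambda>_. states E) 0 (horizon E) (\<lambda>_. undefined)"

definition cumulative_reward :: "('s, 'a) mdp \<Rightarrow> ('s \<Rightarrow> 'a) \<Rightarrow> (nat \<Rightarrow> 's) \<Rightarrow> real" where
  "cumulative_reward E p \<tau> = (\<Sum>t<horizon E. discount E ^ t * reward E (\<tau> t, p (\<tau> t)))"

text \<open>\<open>C(p)\<close>, the expectation over the randomness of the environment.\<close>

definition expected_return :: "('s, 'a) mdp \<Rightarrow> ('s \<Rightarrow> 'a) \<Rightarrow> real" where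
  "expected_return E p = (\<integral>\<tau>. cumulative_reward E p \<tau> \<partial>episode E p)"

text \<open>\<open>J(\<pi>)\<close> for a randomized policy \<open>\<pi>\<close>, a random element on the probability space \<open>\<Omega>\<close> that
  carries the randomness of the training algorithm.\<close>

definition J :: "('s, 'a) mdp \<Rightarrow> 'w measure \<Rightarrow> ('w \<Rightarrow> 's \<Rightarrow> 'a) \<Rightarrow> real" where
  "J E \<Omega> \<pi> = (\<integral>\<sigma>. expected_return E (\<pi> \<sigma>) \<partial>\<Omega>)"

definition return_bounded :: "('s, 'a) mdp \<Rightarrow> real \<Rightarrow> bool" where
  "return_bounded E b \<longleftrightarrow>
     (\<forall>p \<in> policies E. AE \<tau> in episode E p. cumulative_reward E p \<tau> \<in> {0..b})"

text \<open>There is no canonical \<open>\<sigma>\<close>-algebra on the set of policies; any one is allowed that makes the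
  expected return measurable.\<close>

definition policy_space :: "('s, 'a) mdp \<Rightarrow> ('s \<Rightarrow> 'a) measure \<Rightarrow> bool" where
  "policy_space E \<Theta> \<longleftrightarrow>
     space \<Theta> = policies E \<and> expected_return E \<in> borel_measurable \<Theta>"


section \<open>Datasets\<close>

datatype ('s, 'a) data_record =
    Transition "'s \<times> 'a \<times> 's \<times> real"
  | Trajectory "('s \<times> 'a \<times> 's \<times> real) list"

definition transitions :: "('s, 'a) mdp \<Rightarrow> ('s \<times> 'a \<times> 's \<times> real) set" where
  "transitions E = space (states E) \<times> space (actions E) \<times> space (states E) \<times> UNIV"

definition transition_records :: "('s, 'a) mdp \<Rightarrow> ('s, 'a) data_record set" where
  "transition_records E = Transition ` transitions E"

definition trajectory_records :: "('s, 'a) mdp \<Rightarrow> ('s, 'a) data_record set" where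
  "trajectory_records E = Trajectory ` lists (transitions E)"

text \<open>A set of admissible records: all of them transitions, or all of them trajectories. Allowing
  subsets leaves open which sequences of transitions count as trajectories of an episode
  (for example a bound on the length, or that consecutive transitions fit together).\<close>

definition record_format :: "('s, 'a) mdp \<Rightarrow> ('s, 'a) data_record set \<Rightarrow> bool" where
  "record_format E X \<longleftrightarrow> X \<subseteq> transition_records E \<or> X \<subseteq> trajectory_records E"

definition datasets :: "'r set \<Rightarrow> 'r multiset set" where
  "datasets X = {D. set_mset D \<subseteq> X}"

inductive record_change :: "'r set \<Rightarrow> 'r multiset \<Rightarrow> 'r multiset \<Rightarrow> bool" for X where
  addition: "x \<in> X \<Longrightarrow> record_change X D (add_mset x D)"
| deletion: "record_change X (add_mset x D) D"
| alteration: "y \<in> X \<Longrightarrow> record_change X (add_mset x D) (add_mset y D)"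

definition changes_needed :: "'r set \<Rightarrow> 'r multiset \<Rightarrow> 'r multiset \<Rightarrow> nat" where
  "changes_needed X D D' = (LEAST n. (record_change X ^^ n) D D')"

definition dataset_ball :: "'r set \<Rightarrow> 'r multiset \<Rightarrow> nat \<Rightarrow> 'r multiset set" where
  "dataset_ball X D r = {D' \<in> datasets X. changes_needed X D D' \<le> r}"

text \<open>Between datasets the minimum is over a nonempty set, and the neighbour relation is symmetric.\<close>

lemma record_changes_from_empty:
  assumes "D \<in> datasets X"
  shows "(record_change X ^^ size D) {#} D"
  using assms
proof (induction D)
  case (add x D)
  then show ?case
    by (auto simp: datasets_def intro!: relcomppI[of _ _ D] record_change.addition)
qed simp

lemma record_change_datasets:
  "record_change X D D' \<Longrightarrow> D \<in> datasets X \<Longrightarrow> D' \<in> datasets X"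
  by (induction rule: record_change.induct) (auto simp: datasets_def)

lemma record_change_sym:
  "record_change X D D' \<Longrightarrow> D \<in> datasets X \<Longrightarrow> record_change X D' D"
  by (induction rule: record_change.induct) (auto simp: datasets_def intro: record_change.intros)

lemma record_changes_sym:
  "(record_change X ^^ n) D D' \<Longrightarrow> D \<in> datasets X \<Longrightarrow> D' \<in> datasets X \<and> (record_change X ^^ n) D' D"
proof (induction n arbitrary: D')
  case (Suc n)
  then obtain D1 where D1: "(record_change X ^^ n) D D1" "record_change X D1 D'"
    by auto
  with Suc have *: "D1 \<in> datasets X" "(record_change X ^^ n) D1 D"
    by auto
  with D1 have "record_change X D' D1" "D' \<in> datasets X"
    using record_change_sym record_change_datasets by blast+
  with * show ?case
    by (metis relpowp_Suc_I2)
qed simp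

lemma changes_needed_attained:
  assumes "D \<in> datasets X" "D' \<in> datasets X"
  shows "(record_change X ^^ changes_needed X D D') D D'"
proof -
  have "(record_change X ^^ size D) D {#}"
    using record_changes_sym[OF record_changes_from_empty[OF assms(1)]]
    by (simp add: datasets_def)
  then have "(record_change X ^^ (size D + size D')) D D'"
    using record_changes_from_empty[OF assms(2)] by (auto simp: relpowp_add)
  then show ?thesis
    unfolding changes_needed_def by (rule LeastI)
qed

lemma dataset_ball_sym:
  assumes "D \<in> datasets X" "D' \<in> datasets X"
  shows "D' \<in> dataset_ball X D r \<longleftrightarrow> D \<in> dataset_ball X D' r"
proof -
  have "(record_change X ^^ n) D D' \<longleftrightarrow> (record_change X ^^ n) D' D" for n
    using assms record_changes_sym by blast
  then show ?thesis
    using assms by (simp add: dataset_ball_def changes_needed_def)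
qed


section \<open>Outcomes guarantees\<close>

definition outcomes_guarantee ::
  "'w measure \<Rightarrow> 'p measure \<Rightarrow> 'r set \<Rightarrow> ('r multiset \<Rightarrow> 'w \<Rightarrow> 'p) \<Rightarrow>
   (real \<Rightarrow> real) set \<Rightarrow> nat \<Rightarrow> bool" where
  "outcomes_guarantee \<Omega> \<Theta> X M \<K> r \<longleftrightarrow>
     (\<forall>K \<in> \<K>. \<forall>D1 \<in> datasets X. \<forall>D2 \<in> dataset_ball X D1 r. \<forall>S \<in> sets \<Theta>.
        measure \<Omega> {\<sigma> \<in> space \<Omega>. M D1 \<sigma> \<in> S} \<le> K (measure \<Omega> {\<sigma> \<in> space \<Omega>. M D2 \<sigma> \<in> S}))"

text \<open>The functions in \<open>\<K>\<close> are applied to probabilities, so only their values on \<open>[0,1]\<close> matter.\<close>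

definition adp_form :: "(real \<Rightarrow> real) \<Rightarrow> real \<Rightarrow> real \<Rightarrow> bool" where
  "adp_form K \<epsilon> \<delta> \<longleftrightarrow> \<epsilon> > 0 \<and> 0 \<le> \<delta> \<and> \<delta> < 1 \<and> (\<forall>x \<in> {0..1}. K x = exp \<epsilon> * x + \<delta>)"

definition rdp_form :: "(real \<Rightarrow> real) \<Rightarrow> real \<Rightarrow> real \<Rightarrow> bool" where
  "rdp_form K \<epsilon> \<alpha> \<longleftrightarrow>
     \<epsilon> > 0 \<and> \<alpha> > 1 \<and> (\<forall>x \<in> {0..1}. K x = (exp \<epsilon> * x) powr ((\<alpha> - 1) / \<alpha>))"

definition adp_outcomes_guarantee ::
  "'w measure \<Rightarrow> 'p measure \<Rightarrow> 'r set \<Rightarrow> ('r multiset \<Rightarrow> 'w \<Rightarrow> 'p) \<Rightarrow>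
   (real \<Rightarrow> real) set \<Rightarrow> nat \<Rightarrow> bool" where
  "adp_outcomes_guarantee \<Omega> \<Theta> X M \<K> r \<longleftrightarrow>
     outcomes_guarantee \<Omega> \<Theta> X M \<K> r \<and> (\<forall>K \<in> \<K>. \<exists>\<epsilon> \<delta>. adp_form K \<epsilon> \<delta>)"

definition rdp_outcomes_guarantee ::
  "'w measure \<Rightarrow> 'p measure \<Rightarrow> 'r set \<Rightarrow> ('r multiset \<Rightarrow> 'w \<Rightarrow> 'p) \<Rightarrow>
   (real \<Rightarrow> real) set \<Rightarrow> nat \<Rightarrow> bool" where
  "rdp_outcomes_guarantee \<Omega> \<Theta> X M \<K> r \<longleftrightarrow>
     outcomes_guarantee \<Omega> \<Theta> X M \<K> r \<and> (\<forall>K \<in> \<K>. \<exists>\<epsilon> \<alpha>. rdp_form K \<epsilon> \<alpha>)"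

end

theory Submission
  imports Defs
begin

text \<open>By the layer-cake formula, a reward in \<open>[0,b]\<close> has expectation \<open>\<integral>\<^sub>0\<^sup>b Pr[C(\<pi>) > t] dt\<close>, so an affine
  guarantee \<open>K(x) = A x + B\<close> applied to the superlevel sets of \<open>C\<close> integrates to
  \<open>J(\<pi>) \<le> A J(\<pi>') + B b\<close>. This is the ADP bound. The RDP function \<open>K\<close> is concave, hence lies below each of
  its tangents; the affine bound for the tangent at the point where \<open>K\<close> takes the value \<open>J(\<pi>) / b\<close>
  is the RDP bound.\<close>

section \<open>Layer-cake integration and affine tail bounds\<close>

text \<open>Both sides are the product measure of the region under the graph of \<open>f\<close>:
  integrating over \<open>t\<close> first gives \<open>f x\<close>, integrating over
  \<open>x\<close> first gives the measure of a superlevel set. Sigma-finiteness lets Tonelli's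
  theorem swap the integrals.\<close>

lemma (in sigma_finite_measure) nn_integral_layer_cake:
  fixes f :: "'a \<Rightarrow> real"
  assumes [measurable]: "f \<in> borel_measurable M"
    and nonneg: "\<And>x. x \<in> space M \<Longrightarrow> 0 \<le> f x"
  shows "(\<integral>\<^sup>+x. f x \<partial>M) = (\<integral>\<^sup>+t. emeasure M {x \<in> space M. t < f x} * indicator {0..} t \<partial>lborel)"
proof -
  interpret pair_sigma_finite M lborel ..
  define g :: "'a \<times> real \<Rightarrow> ennreal"
    where "g = (\<lambda>(x, t). indicator {z \<in> space (M \<Otimes>\<^sub>M lborel). 0 \<le> snd z \<and> snd z < f (fst z)} (x, t))"
  have [measurable]: "g \<in> borel_measurable (M \<Otimes>\<^sub>M lborel)"
    unfolding g_def by measurable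
  have "(\<integral>\<^sup>+t. g (x, t) \<partial>lborel) = f x" if "x \<in> space M" for x
  proof -
    have "(\<integral>\<^sup>+t. g (x, t) \<partial>lborel) = (\<integral>\<^sup>+t. indicator {0..<f x} t \<partial>lborel)"
      using that by (intro nn_integral_cong) (auto simp: g_def space_pair_measure split: split_indicator)
    then show ?thesis
      using nonneg[OF that] by simp
  qed
  then have "(\<integral>\<^sup>+x. f x \<partial>M) = (\<integral>\<^sup>+x. \<integral>\<^sup>+t. g (x, t) \<partial>lborel \<partial>M)"
    by (intro nn_integral_cong) simp
  also have "\<dots> = (\<integral>\<^sup>+t. \<integral>\<^sup>+x. g (x, t) \<partial>M \<partial>lborel)"
    by (rule Fubini'[symmetric]) simp
  also have "\<dots> = (\<integral>\<^sup>+t. emeasure M {x \<in> space M. t < f x} * indicator {0..} t \<partial>lborel)"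
  proof (rule nn_integral_cong)
    fix t :: real
    have "(\<integral>\<^sup>+x. g (x, t) \<partial>M)
        = (\<integral>\<^sup>+x. indicator {x \<in> space M. t < f x} x * indicator {0..} t \<partial>M)"
      by (intro nn_integral_cong) (auto simp: g_def space_pair_measure split: split_indicator)
    also have "\<dots> = emeasure M {x \<in> space M. t < f x} * indicator {0..} t"
      by (subst nn_integral_multc) auto
    finally show "(\<integral>\<^sup>+x. g (x, t) \<partial>M) = emeasure M {x \<in> space M. t < f x} * indicator {0..} t" .
  qed
  finally show ?thesis .
qed

text \<open>Integrate \<open>le\<close> over the levels \<open>t\<close> in \<open>[0,b]\<close>.
  Superlevel sets of \<open>X\<close> above \<open>b\<close> are empty, so the constant
  \<open>B\<close> is paid only on an interval of length \<open>b\<close>.\<close>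

lemma (in prob_space) expectation_le_affine:
  fixes X Y :: "'a \<Rightarrow> real"
  assumes [measurable]: "X \<in> borel_measurable M" "Y \<in> borel_measurable M"
    and X: "\<And>x. x \<in> space M \<Longrightarrow> X x \<in> {0..b}"
    and Y: "\<And>x. x \<in> space M \<Longrightarrow> Y x \<in> {0..b}"
    and "0 \<le> A" "0 \<le> B"
    and le: "\<And>t. prob {x \<in> space M. t < X x} \<le> A * prob {x \<in> space M. t < Y x} + B"
  shows "expectation X \<le> A * expectation Y + B * b"
proof -
  have "0 \<le> b"
    using X not_empty by fastforce
  \<comment> \<open>The comparison runs in nonnegative integrals; \<open>bdd\<close> and
    \<open>nn\<close> translate these to real expectations.\<close>
  have bdd: "integrable M Z \<and> 0 \<le> expectation Z"
    if "Z \<in> borel_measurable M" "\<And>x. x \<in> space M \<Longrightarrow> Z x \<in> {0..b}" for Z :: "'a \<Rightarrow> real"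
    using that by (auto intro!: integrable_const_bound[where B = b] integral_nonneg_AE AE_I2)
  have nn: "ennreal (expectation Z) = (\<integral>\<^sup>+x. Z x \<partial>M)"
    if "Z \<in> borel_measurable M" "\<And>x. x \<in> space M \<Longrightarrow> Z x \<in> {0..b}" for Z :: "'a \<Rightarrow> real"
    using bdd[OF that] that by (subst nn_integral_eq_integral) (auto intro!: AE_I2)
  let ?P = "\<lambda>Z t. emeasure M {x \<in> space M. t < (Z x :: real)}"
  have "ennreal (expectation X) = (\<integral>\<^sup>+t. ?P X t * indicator {0..} t \<partial>lborel)"
    using X by (subst nn) (auto intro!: nn_integral_layer_cake)
  also have "\<dots> \<le> (\<integral>\<^sup>+t. ennreal A * (?P Y t * indicator {0..} t) + ennreal B * indicator {0..b} t \<partial>lborel)"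
  proof (rule nn_integral_mono)
    fix t :: real
    show "?P X t * indicator {0..} t \<le> ennreal A * (?P Y t * indicator {0..} t) + ennreal B * indicator {0..b} t"
    proof (cases "0 \<le> t \<and> t \<le> b")
      case True
      have "?P X t \<le> A * ?P Y t + B"
        using le[of t] \<open>0 \<le> A\<close> \<open>0 \<le> B\<close>
        by (simp add: emeasure_eq_measure flip: ennreal_mult ennreal_plus)
      with True show ?thesis
        by simp
    next
      \<comment> \<open>The left side vanishes here: by the indicator for \<open>t < 0\<close>, by
        emptiness of the superlevel set for \<open>b < t\<close>.\<close>
      case False
      have "?P X t = 0" if "b < t"
      proof -
        have "{x \<in> space M. t < X x} = {}"
          using X that by fastforce
        then show ?thesis
          by (simp only: emeasure_empty)
      qed
      with False show ?thesis
        by (auto split: split_indicator)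
    qed
  qed
  also have "\<dots> = A * (\<integral>\<^sup>+t. ?P Y t * indicator {0..} t \<partial>lborel) + B * ennreal b"
    using \<open>0 \<le> b\<close> by (simp add: nn_integral_add nn_integral_cmult)
  also have "(\<integral>\<^sup>+t. ?P Y t * indicator {0..} t \<partial>lborel) = ennreal (expectation Y)"
    using Y by (subst nn) (auto intro!: nn_integral_layer_cake[symmetric])
  also have "A * ennreal (expectation Y) + B * ennreal b = ennreal (A * expectation Y + B * b)"
    using \<open>0 \<le> A\<close> \<open>0 \<le> B\<close> \<open>0 \<le> b\<close> bdd[of Y] Y by (simp add: ennreal_mult)
  finally show ?thesis
    using \<open>0 \<le> A\<close> \<open>0 \<le> B\<close> \<open>0 \<le> b\<close> bdd[of Y] Y by (subst (asm) ennreal_le_iff) auto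
qed

section \<open>Power tail bounds by tangent lines\<close>

lemma powr_le_tangent:
  fixes \<beta> c x :: real
  assumes "0 < \<beta>" "\<beta> < 1" "0 < c" "0 \<le> x"
  shows "x powr \<beta> \<le> \<beta> * c powr (\<beta> - 1) * x + (1 - \<beta>) * c powr \<beta>"
proof (cases "x = 0")
  case False
  \<comment> \<open>Inserting \<open>c powr (\<beta> - 1) * c powr (1 - \<beta>) = 1\<close> exposes
    the weighted geometric mean of \<open>x\<close> and \<open>c\<close>, which Young's inequality
    bounds by their weighted arithmetic mean.\<close>
  have "x powr \<beta> = c powr (\<beta> - 1) * (x powr \<beta> * c powr (1 - \<beta>))"
    using assms by (simp add: powr_diff)
  also have "\<dots> \<le> c powr (\<beta> - 1) * (\<beta> * x + (1 - \<beta>) * c)"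
    using assms False by (intro mult_left_mono Youngs_inequality_0) auto
  also have "\<dots> = \<beta> * c powr (\<beta> - 1) * x + (1 - \<beta>) * c powr \<beta>"
    using assms by (simp add: powr_diff field_simps)
  finally show ?thesis .
qed (use assms in simp)

text \<open>This is Jensen's inequality for the average over levels in \<open>[0,b]\<close>, namely
  \<open>expectation X / b \<le> (L * expectation Y / b) powr \<beta>\<close>, solved for
  \<open>expectation Y\<close>.\<close>

lemma (in prob_space) expectation_le_powr:
  fixes X Y :: "'a \<Rightarrow> real"
  assumes [measurable]: "X \<in> borel_measurable M" "Y \<in> borel_measurable M"
    and X: "\<And>x. x \<in> space M \<Longrightarrow> X x \<in> {0..b}"
    and Y: "\<And>x. x \<in> space M \<Longrightarrow> Y x \<in> {0..b}"
    and "0 < b" "0 < \<beta>" "\<beta> < 1" "0 \<le> L"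
    and le: "\<And>t. prob {x \<in> space M. t < X x} \<le> (L * prob {x \<in> space M. t < Y x}) powr \<beta>"
  shows "b * (expectation X / b) powr (1 / \<beta>) \<le> L * expectation Y"
proof -
  have nonneg: "0 \<le> expectation X" "0 \<le> expectation Y"
    using X Y by (auto intro!: integral_nonneg_AE AE_I2)
  show ?thesis
  proof (cases "expectation X = 0")
    \<comment> \<open>A tangent needs a positive point of contact, so expectation 0 is treated
      apart; there \<open>0 powr (1 / \<beta>) = 0\<close>.\<close>
    case True
    then show ?thesis
      using nonneg \<open>0 \<le> L\<close> by simp
  next
    case False
    define u where "u = expectation X / b"
    have "0 < u"
      using False nonneg \<open>0 < b\<close> by (simp add: u_def)
    \<comment> \<open>The positivity of this tangency point comes from that of \<open>u\<close>; the
      other natural choice, \<open>L * expectation Y / b\<close>, would first require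
      \<open>0 < expectation Y\<close>.\<close>
    define c where "c = u powr (1 / \<beta>)"
    have "0 < c" and c: "c powr \<beta> = u"
      using \<open>0 < u\<close> \<open>0 < \<beta>\<close> by (auto simp: c_def powr_powr)
    have "expectation X \<le> (\<beta> * c powr (\<beta> - 1) * L) * expectation Y + ((1 - \<beta>) * c powr \<beta>) * b"
    proof (rule expectation_le_affine[OF _ _ X Y])
      fix t
      let ?q = "L * prob {x \<in> space M. t < Y x}"
      have "?q powr \<beta> \<le> \<beta> * c powr (\<beta> - 1) * ?q + (1 - \<beta>) * c powr \<beta>"
        using assms \<open>0 < c\<close> by (intro powr_le_tangent) auto
      with le[of t] show "prob {x \<in> space M. t < X x}
          \<le> \<beta> * c powr (\<beta> - 1) * L * prob {x \<in> space M. t < Y x} + (1 - \<beta>) * c powr \<beta>"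
        by (simp add: mult.assoc)
    qed (use assms in auto)
    moreover have "expectation X = u * b"
      using \<open>0 < b\<close> by (simp add: u_def)
    moreover have "c powr (\<beta> - 1) = u / c"
      using \<open>0 < c\<close> c by (simp add: powr_diff)
    ultimately have "u * b \<le> \<beta> * (u / c) * L * expectation Y + (1 - \<beta>) * u * b"
      by (simp add: c)
    \<comment> \<open>Subtracting \<open>(1 - \<beta>) * u * b\<close> leaves
      \<open>\<beta> * u * b\<close> on the left; multiplying by \<open>c\<close> then makes the
      positive factor \<open>\<beta> * u\<close> common to both sides.\<close>
    then have "\<beta> * u * (c * b) \<le> \<beta> * u * (L * expectation Y)"
      using \<open>0 < c\<close> by (simp add: field_simps)
    then have "c * b \<le> L * expectation Y"
      by (rule mult_left_le_imp_le) (use \<open>0 < \<beta>\<close> \<open>0 < u\<close> in simp)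
    then show ?thesis
      unfolding c_def u_def by (simp only: mult.commute)
  qed
qed

section \<open>Episodes and returns of a single policy\<close>

text \<open>A finite composition of Markov kernels has mass one. Each step is such a kernel: it is
  either the constant initial law or the transition kernel applied to the last state and its action,
  measurably in the history.\<close>

lemma prob_space_episode:
  assumes E: "valid_mdp E" and p: "p \<in> policies E"
  shows "prob_space (episode E p)"
proof -
  have [measurable]: "p \<in> states E \<rightarrow>\<^sub>M actions E"
    "transition E \<in> states E \<Otimes>\<^sub>M actions E \<rightarrow>\<^sub>M prob_algebra (states E)"
    using assms by (auto simp: valid_mdp_def policies_def)
  have next_state: "next_state E p t \<in> PiM {0..<t} (\<lambda>_. states E) \<rightarrow>\<^sub>M prob_algebra (states E)" for t
  proof (cases t)
    case 0
    have "next_state E p 0 = (\<lambda>_. initial E)"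
      by auto
    then show ?thesis
      using E 0 by (simp add: valid_mdp_def)
  next
    case (Suc n)
    have "next_state E p t = (\<lambda>\<tau>. transition E (\<tau> n, p (\<tau> n)))"
      using Suc by auto
    moreover have "(\<lambda>\<tau>. \<tau> n) \<in> PiM {0..<t} (\<lambda>_. states E) \<rightarrow>\<^sub>M states E"
      using Suc by (intro measurable_component_singleton) auto
    ultimately show ?thesis
      by simp
  qed
  interpret Ionescu_Tulcea "next_state E p" "\<lambda>_. states E"
  proof (rule Ionescu_Tulcea.intro)
    show "next_state E p t \<in> PiM {0..<t} (\<lambda>_. states E) \<rightarrow>\<^sub>M subprob_algebra (states E)" for t
      using next_state by (rule measurable_prob_algebraD)
    show "prob_space (next_state E p t \<tau>)" if "\<tau> \<in> space (PiM {0..<t} (\<lambda>_. states E))" for t \<tau>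
      using measurable_space[OF next_state that] by (simp add: space_prob_algebra)
  qed
  \<comment> \<open>What remains is that the starting point \<open>\<lambda>_. undefined\<close>
    lies in the empty product.\<close>
  show ?thesis
    unfolding episode_def by (rule prob_space_C) (simp add: space_PiM)
qed

text \<open>Averaging over episodes turns the almost-everywhere reward bound into one valid for
  every policy, as the tail comparison requires.\<close>

lemma expected_return_bounds:
  assumes "valid_mdp E" "return_bounded E b" "0 < b" "p \<in> policies E"
  shows "expected_return E p \<in> {0..b}"
proof -
  interpret prob_space "episode E p"
    using assms by (intro prob_space_episode)
  have bdd: "AE \<tau> in episode E p. cumulative_reward E p \<tau> \<in> {0..b}"
    using assms by (auto simp: return_bounded_def)
  then have "0 \<le> expected_return E p"
    unfolding expected_return_def by (intro integral_nonneg_AE) auto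
  moreover have "expected_return E p \<le> b"
  proof (cases "integrable (episode E p) (cumulative_reward E p)")
    case True
    then show ?thesis
      unfolding expected_return_def using bdd by (intro integral_le_const) auto
  next
    \<comment> \<open>The Bochner integral of a non-integrable function is 0 by convention, which
      also lies below \<open>b\<close>.\<close>
    case False
    then show ?thesis
      using \<open>0 < b\<close> by (simp add: expected_return_def not_integrable_integral_eq)
  qed
  ultimately show ?thesis
    by simp
qed


theorem theorem4p2:
  fixes E :: "('s, 'a) mdp"
    and \<Omega> :: "'w measure"
    and \<Theta> :: "('s \<Rightarrow> 'a) measure"
    and X :: "('s, 'a) data_record set"
    and M :: "('s, 'a) data_record multiset \<Rightarrow> 'w \<Rightarrow> 's \<Rightarrow> 'a"
    and D :: "('s, 'a) data_record multiset"
    and \<K> :: "(real \<Rightarrow> real) set"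
    and r :: nat
    and b :: real
  assumes "valid_mdp E"
    and "b > 0"
    and "return_bounded E b"
    and "prob_space \<Omega>"
    and "policy_space E \<Theta>"
    and "record_format E X"
    and "\<And>D'. D' \<in> datasets X \<Longrightarrow> M D' \<in> \<Omega> \<rightarrow>\<^sub>M \<Theta>"
    and "D \<in> datasets X"
  shows
    "(adp_outcomes_guarantee \<Omega> \<Theta> X M \<K> r \<longrightarrow>
        (\<forall>K \<in> \<K>. \<forall>\<epsilon> \<delta>. adp_form K \<epsilon> \<delta> \<longrightarrow>
           (\<forall>D' \<in> dataset_ball X D r.
              J E \<Omega> (M D') \<ge> exp (- \<epsilon>) * (J E \<Omega> (M D) - b * \<delta>)))) \<and>
     (rdp_outcomes_guarantee \<Omega> \<Theta> X M \<K> r \<longrightarrow>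
        (\<forall>K \<in> \<K>. \<forall>\<epsilon> \<alpha>. rdp_form K \<epsilon> \<alpha> \<longrightarrow>
           (\<forall>D' \<in> dataset_ball X D r.
              J E \<Omega> (M D') \<ge>
                exp (- \<epsilon>) * (b powr (- 1 / \<alpha>) * J E \<Omega> (M D)) powr (\<alpha> / (\<alpha> - 1)))))"
proof -
  interpret prob_space \<Omega>
    by fact
  let ?C = "expected_return E"
  have meas: "(\<lambda>\<sigma>. ?C (M D1 \<sigma>)) \<in> borel_measurable \<Omega>"
    and range: "\<sigma> \<in> space \<Omega> \<Longrightarrow> ?C (M D1 \<sigma>) \<in> {0..b}" if "D1 \<in> datasets X" for D1 \<sigma>
  proof -
    have \<Theta>: "space \<Theta> = policies E" "?C \<in> borel_measurable \<Theta>"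
      using assms(5) by (auto simp: policy_space_def)
    show "(\<lambda>\<sigma>. ?C (M D1 \<sigma>)) \<in> borel_measurable \<Omega>"
      using measurable_compose[OF assms(7)[OF that] \<Theta>(2)] .
    show "?C (M D1 \<sigma>) \<in> {0..b}" if "\<sigma> \<in> space \<Omega>"
      using measurable_space[OF assms(7)[OF \<open>D1 \<in> datasets X\<close>] that] \<Theta>(1) assms(1-3)
      by (intro expected_return_bounds) auto
  qed
  have tail: "prob {\<sigma> \<in> space \<Omega>. t < ?C (M D \<sigma>)} \<le> K (prob {\<sigma> \<in> space \<Omega>. t < ?C (M D' \<sigma>)})"
    if "outcomes_guarantee \<Omega> \<Theta> X M \<K> r" "K \<in> \<K>" "D' \<in> dataset_ball X D r" for K D' t
  proof -
    \<comment> \<open>The test event consists of the policies with return above \<open>t\<close>;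
      \<open>policy_space\<close> makes it measurable, and its preimage under \<open>M D1\<close> is
      a superlevel set of the return.\<close>
    let ?S = "{p \<in> space \<Theta>. t < ?C p}"
    have [measurable]: "?C \<in> borel_measurable \<Theta>"
      using assms(5) by (simp add: policy_space_def)
    have *: "{\<sigma> \<in> space \<Omega>. M D1 \<sigma> \<in> ?S} = {\<sigma> \<in> space \<Omega>. t < ?C (M D1 \<sigma>)}"
      if "D1 \<in> datasets X" for D1
      using measurable_space[OF assms(7)[OF that]] by auto
    have "?S \<in> sets \<Theta>"
      by measurable
    \<comment> \<open>The clean \<open>D\<close> takes the first place in the guarantee and the
      poisoned \<open>D'\<close> the second, so the clean tail is bounded through the poisoned
      one.\<close>
    then have "prob {\<sigma> \<in> space \<Omega>. M D \<sigma> \<in> ?S} \<le> K (prob {\<sigma> \<in> space \<Omega>. M D' \<sigma> \<in> ?S})"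
      using that assms(8) unfolding outcomes_guarantee_def by blast
    moreover have "D' \<in> datasets X"
      using that by (simp add: dataset_ball_def)
    ultimately show ?thesis
      using assms(8) by (simp only: *)
  qed
  have "exp (- \<epsilon>) * (J E \<Omega> (M D) - b * \<delta>) \<le> J E \<Omega> (M D')"
    if "adp_outcomes_guarantee \<Omega> \<Theta> X M \<K> r" "K \<in> \<K>" "adp_form K \<epsilon> \<delta>"
      "D' \<in> dataset_ball X D r" for K \<epsilon> \<delta> D'
  proof -
    have D': "D' \<in> datasets X"
      using that by (simp add: dataset_ball_def)
    have "J E \<Omega> (M D) \<le> exp \<epsilon> * J E \<Omega> (M D') + \<delta> * b"
      unfolding J_def
    proof (rule expectation_le_affine[OF meas[OF assms(8)] meas[OF D'] range[OF assms(8)] range[OF D']])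
      \<comment> \<open>\<open>adp_form\<close> fixes \<open>K\<close> on \<open>[0,1]\<close> only,
        which contains the probability it is applied to.\<close>
      show "prob {\<sigma> \<in> space \<Omega>. t < ?C (M D \<sigma>)}
          \<le> exp \<epsilon> * prob {\<sigma> \<in> space \<Omega>. t < ?C (M D' \<sigma>)} + \<delta>" for t
        using tail[of K D' t] that by (simp add: adp_outcomes_guarantee_def adp_form_def)
    qed (use that in \<open>auto simp: adp_form_def\<close>)
    then show ?thesis
      by (simp add: exp_minus field_simps)
  qed
  moreover have "exp (- \<epsilon>) * (b powr (- 1 / \<alpha>) * J E \<Omega> (M D)) powr (\<alpha> / (\<alpha> - 1)) \<le> J E \<Omega> (M D')"
    if "rdp_outcomes_guarantee \<Omega> \<Theta> X M \<K> r" "K \<in> \<K>" "rdp_form K \<epsilon> \<alpha>"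
      "D' \<in> dataset_ball X D r" for K \<epsilon> \<alpha> D'
  proof -
    have D': "D' \<in> datasets X" and "1 < \<alpha>"
      using that by (auto simp: dataset_ball_def rdp_form_def)
    have "0 \<le> J E \<Omega> (M D)"
      unfolding J_def using range[OF assms(8)] by (auto intro!: integral_nonneg_AE AE_I2)
    \<comment> \<open>The power bound is used with \<open>L = exp \<epsilon>\<close> and
      \<open>\<beta> = (\<alpha> - 1) / \<alpha>\<close>.\<close>
    have "b * (J E \<Omega> (M D) / b) powr (1 / ((\<alpha> - 1) / \<alpha>)) \<le> exp \<epsilon> * J E \<Omega> (M D')"
      unfolding J_def
    proof (rule expectation_le_powr[OF meas[OF assms(8)] meas[OF D'] range[OF assms(8)] range[OF D']])
      show "prob {\<sigma> \<in> space \<Omega>. t < ?C (M D \<sigma>)}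
          \<le> (exp \<epsilon> * prob {\<sigma> \<in> space \<Omega>. t < ?C (M D' \<sigma>)}) powr ((\<alpha> - 1) / \<alpha>)" for t
        using tail[of K D' t] that by (simp add: rdp_outcomes_guarantee_def rdp_form_def)
    qed (use \<open>1 < \<alpha>\<close> assms(2) in auto)
    also have "b * (J E \<Omega> (M D) / b) powr (1 / ((\<alpha> - 1) / \<alpha>))
        = (b powr (- 1 / \<alpha>) * J E \<Omega> (M D)) powr (\<alpha> / (\<alpha> - 1))"
    proof -
      \<comment> \<open>The total exponent of \<open>b\<close> is
        \<open>- 1 / (\<alpha> - 1)\<close>, which factors as
        \<open>(- 1 / \<alpha>) * (\<alpha> / (\<alpha> - 1))\<close>; this moves \<open>b\<close>
        inside the power.\<close>
      have "1 - \<alpha> / (\<alpha> - 1) = - 1 / (\<alpha> - 1)"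
        using \<open>1 < \<alpha>\<close> by (simp add: field_simps)
      then have "b * (J E \<Omega> (M D) / b) powr (\<alpha> / (\<alpha> - 1))
          = b powr (- 1 / (\<alpha> - 1)) * J E \<Omega> (M D) powr (\<alpha> / (\<alpha> - 1))"
        using \<open>0 < b\<close> \<open>0 \<le> J E \<Omega> (M D)\<close> powr_diff[of b 1 "\<alpha> / (\<alpha> - 1)"]
        by (simp add: powr_divide)
      also have "b powr (- 1 / (\<alpha> - 1)) = (b powr (- 1 / \<alpha>)) powr (\<alpha> / (\<alpha> - 1))"
        using \<open>1 < \<alpha>\<close> by (simp add: powr_powr)
      finally show ?thesis
        using \<open>0 \<le> J E \<Omega> (M D)\<close> by (simp add: powr_mult)
    qed
    finally show ?thesis
      by (simp add: exp_minus field_simps)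
  qed
  ultimately show ?thesis
    by blast
qed

end
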